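(* Let $K, L \subset \mathbb{R}^3$ be convex bodies containing the origin as an interior point. Suppose that for every $\xi \in S^2$ the projection $K_{|\xi^{\perp}}$ can be rotated about the origin into $L_{|\xi^{\perp}}$, i.e. there is a rotation $\Phi_\xi$ of the plane $\xi^{\perp}$ about the origin with $\Phi_\xi(K_{|\xi^{\perp}}) = L_{|\xi^{\perp}}$. Then either $K = L$ or $K = -L$ (that is, $K$ is obtained by reflecting $L$ about the origin).
   Context: $S^2$ is the unit sphere of $\mathbb{R}^3$. A convex body is a compact convex set with nonempty interior. For $\xi \in S^2$, $\xi^{\perp} = \{x \in \mathbb{R}^3 : x \cdot \xi = 0\}$, and the orthogonal projection of $K$ in the direction $\xi$ is $K_{|\xi^{\perp}} = \{y \in \xi^{\perp} : \exists \lambda \in \mathbb{R},\ y + \lambda \xi \in K\}$. A rotation of the plane $\xi^\perp$ about the origin is an orientation-preserving linear isometry of $\xi^\perp$ (an element of $SO(2)$); the rotation may depend on $\xi$, with no continuity assumed. Reflection about the origin is the map $x \mapsto -x$. *)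

theory Defs
  imports "HOL-Analysis.Analysis"
begin

definition convex_body :: "'a::euclidean_space set \<Rightarrow> bool" where
  "convex_body K \<longleftrightarrow> compact K \<and> convex K \<and> interior K \<noteq> {}"

definition perp :: "real^3 \<Rightarrow> (real^3) set" where
  "perp \<xi> = {x. x \<bullet> \<xi> = 0}"

definition projection :: "real^3 \<Rightarrow> (real^3) set \<Rightarrow> (real^3) set" where
  "projection \<xi> K = {y \<in> perp \<xi>. \<exists>t::real. y + t *\<^sub>R \<xi> \<in> K}"

text \<open>
  Rotations of the plane \<open>perp \<xi>\<close> about the origin, for \<open>\<xi> \<noteq> 0\<close>. All conditions are relativised
  to the plane; the values of \<open>\<phi>\<close> outside it are irrelevant. The plane is oriented by its
  normal \<open>\<xi>\<close>: a pair \<open>x, y\<close> of its vectors is a positively oriented basis iff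
  \<open>\<xi> \<bullet> cross3 x y > 0\<close>. Whether a map of the plane to itself preserves orientation does not
  depend on which of the two orientations is used.
\<close>

definition plane_rotation :: "real^3 \<Rightarrow> (real^3 \<Rightarrow> real^3) \<Rightarrow> bool" where
  "plane_rotation \<xi> \<phi> \<longleftrightarrow>
     \<phi> ` perp \<xi> = perp \<xi> \<and>
     (\<forall>x\<in>perp \<xi>. \<forall>y\<in>perp \<xi>. \<phi> (x + y) = \<phi> x + \<phi> y) \<and>
     (\<forall>c. \<forall>x\<in>perp \<xi>. \<phi> (c *\<^sub>R x) = c *\<^sub>R \<phi> x) \<and>
     (\<forall>x\<in>perp \<xi>. norm (\<phi> x) = norm x) \<and>
     (\<forall>x\<in>perp \<xi>. \<forall>y\<in>perp \<xi>. \<xi> \<bullet> cross3 x y > 0 \<longrightarrow> \<xi> \<bullet> cross3 (\<phi> x) (\<phi> y) > 0)"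

end

theory Submission
  imports Defs
begin

text \<open>
  The support function of a projection of \<open>K\<close> is the restriction of the support function
  of \<open>K\<close> to the plane of projection, so the theorem is a statement about functions: let \<open>f\<close>
  (from \<open>L\<close>) and \<open>g\<close> (from \<open>K\<close>) be continuous and positively homogeneous on space, and
  suppose that on every plane through the origin a rotation of the plane turns one into the
  other; then \<open>g x = f x\<close> for all \<open>x\<close> or \<open>g x = f (- x)\<close> for all \<open>x\<close> (\<open>continual_rubik\<close>). This
  functional form is Ryabogin's theorem on the continual Rubik's cube.

  The rotations enter first through integrals. Over every great circle, the powers of \<open>f\<close> and
  of \<open>g\<close> have equal integrals, and a function whose great circle integrals all vanish is odd on
  the sphere (\<open>Funk_injective\<close>). For first and second powers this says that
  \<open>{f x, f (- x)} = {g x, g (- x)}\<close> at each point \<open>x\<close> of the sphere (\<open>power_sums_agree\<close>); what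
  remains is to exclude that the matching of the two values changes from point to point.

  If the angle of the rotation about \<open>\<xi>\<close> is incommensurable with \<open>2 \<pi>\<close>, then all functions
  on the circle that are symmetric in \<open>f x\<close> and \<open>f (- x)\<close> are invariant under a dense group of
  rotations, which forces \<open>f\<close> to be constant on the circle; the angle may then be taken to be
  \<open>0\<close> (\<open>irrational_turn\<close>). So countably many angles suffice, each of them serves a closed set
  of axes, and by Baire's theorem the axes that are interior to one of these sets are dense.

  At an interior axis with angle \<open>\<alpha>\<close> the same rotation angle works for all neighbouring axes.
  If \<open>sin \<alpha> \<noteq> 0\<close>, this says that \<open>f y = g x\<close> for all unit vectors \<open>x\<close>, \<open>y\<close> with
  \<open>x \<bullet> y = cos \<alpha>\<close> for which \<open>cross3 x y / sin \<alpha>\<close> is one of these axes. Chains of such pairs move along the circle, so \<open>g\<close>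
  is constant on it (\<open>locally_constant_on_circle\<close>) and \<open>f = g\<close> there (\<open>interior_turn\<close>). Hence
  for a dense set of axes the angle is \<open>0\<close> or \<open>\<pi>\<close>, and since this is a closed condition it
  holds for all axes. Finally, if \<open>f x \<noteq> g x\<close> and \<open>f (- y) \<noteq> g y\<close>, then a plane through the
  origin, \<open>x\<close> and \<open>y\<close> admits neither angle.
\<close>

section \<open>Periodic functions\<close>

lemma periodic_shift_int:
  fixes h :: "real \<Rightarrow> 'a"
  assumes "\<And>t. h (t + T) = h t"
  shows "h (t + of_int n * T) = h t"
proof (induction n rule: int_induct[where k = 0])
  case base
  show ?case by simp
next
  case (step1 i)
  then show ?case
    using assms[of "t + of_int i * T"] by (simp add: algebra_simps)
next
  case (step2 i)
  then show ?case
    using assms[of "t + of_int (i - 1) * T"] by (simp add: algebra_simps)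
qed

lemma integral_periodic_shift:
  fixes h :: "real \<Rightarrow> real"
  assumes cont: "continuous_on UNIV h" and T: "T > 0" and per: "\<And>t. h (t + T) = h t"
  shows "integral {0..T} (\<lambda>t. h (t + a)) = integral {0..T} h"
proof -
  define b where "b = a - of_int \<lfloor>a / T\<rfloor> * T"
  have b: "0 \<le> b" "b \<le> T"
    using floor_divide_lower[OF T, of a] floor_divide_upper[OF T, of a]
    by (auto simp: b_def algebra_simps)
  have int: "h integrable_on {x..y}" for x y
    by (rule integrable_continuous_real) (rule continuous_on_subset[OF cont], simp)
  have "h (t + a) = h (b + t)" for t
    using periodic_shift_int[of h T "t + b" "\<lfloor>a / T\<rfloor>"] per by (simp add: b_def algebra_simps)
  then have "integral {0..T} (\<lambda>t. h (t + a)) = integral {0..T} (h \<circ> (+) b)"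
    by (simp add: o_def)
  also have "\<dots> = integral {b..T + b} h"
    by (simp only: integral_shift_Icc_real add_0)
  also have "\<dots> = integral {b..T} h + integral {T..T + b} h"
    using Henstock_Kurzweil_Integration.integral_combine[where f = h and a = b and c = T and b = "T + b"] b int by simp
  also have "integral {T..T + b} h = integral {0..b} (h \<circ> (+) T)"
    by (simp only: integral_shift_Icc_real add_0 add.commute)
  also have "\<dots> = integral {0..b} h"
    using per by (simp add: o_def add.commute)
  also have "integral {b..T} h + integral {0..b} h = integral {0..T} h"
    using Henstock_Kurzweil_Integration.integral_combine[OF b int] by simp
  finally show ?thesis .
qed

section \<open>An Abel integral equation\<close>

definition wallis :: "nat \<Rightarrow> real" where
  "wallis n = integral {0..pi} (\<lambda>t. sin t ^ n)"

lemma integrable_on_cont: "continuous_on UNIV f \<Longrightarrow> f integrable_on {a..b}" for f :: "real \<Rightarrow> real"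
  by (rule integrable_continuous_real) (rule continuous_on_subset, auto)

lemma wallis_recurrence: "real (n + 2) * wallis (n + 2) = real (n + 1) * wallis n"
proof -
  have "((\<lambda>t. real (n + 1) * sin t ^ n - real (n + 2) * sin t ^ (n + 2)) has_integral
          (sin pi ^ (n + 1) * cos pi - sin 0 ^ (n + 1) * cos 0)) {0..pi}"
  proof (rule fundamental_theorem_of_calculus)
    fix t :: real
    have c: "cos t * cos t = 1 - sin t * sin t"
      using sin_cos_squared_add[of t] by (simp add: power2_eq_square algebra_simps)
    have eq: "real (n + 1) * sin t ^ n * (cos t * cos t) - sin t ^ (n + 1) * sin t
        = real (n + 1) * sin t ^ n - real (n + 2) * sin t ^ (n + 2)"
      unfolding c by (simp add: algebra_simps)
    have "((\<lambda>t. sin t ^ (n + 1) * cos t) has_real_derivative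
        real (n + 1) * sin t ^ n * (cos t * cos t) - sin t ^ (n + 1) * sin t) (at t within {0..pi})"
      by (rule derivative_eq_intros refl | simp add: algebra_simps)+
    then show "((\<lambda>t. sin t ^ (n + 1) * cos t) has_vector_derivative
        real (n + 1) * sin t ^ n - real (n + 2) * sin t ^ (n + 2)) (at t within {0..pi})"
      unfolding eq by (simp add: has_real_derivative_iff_has_vector_derivative)
  qed simp
  then have "integral {0..pi} (\<lambda>t. real (n + 1) * sin t ^ n - real (n + 2) * sin t ^ (n + 2)) = 0"
    by (auto dest: integral_unique)
  moreover have "integral {0..pi} (\<lambda>t. real (n + 1) * sin t ^ n - real (n + 2) * sin t ^ (n + 2))
      = real (n + 1) * wallis n - real (n + 2) * wallis (n + 2)"
    unfolding wallis_def
    by (subst integral_diff) (auto intro!: integrable_on_cont continuous_intros simp del: power_Suc)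
  ultimately show ?thesis by simp
qed

text \<open>
  The recurrence makes \<open>(n + 1) * (wallis n * wallis (n + 1))\<close> independent of \<open>n\<close>. The
  single integrals depend on the parity of \<open>n\<close>, but products of neighbours do not.
\<close>
lemma wallis_product: "wallis n * wallis (Suc n) = 2 * pi / real (Suc n)"
proof (induction n)
  case 0
  have "((\<lambda>t. sin t) has_integral (- cos pi - - cos 0)) {0..pi}"
    by (rule fundamental_theorem_of_calculus)
      (auto intro!: derivative_eq_intros simp: has_real_derivative_iff_has_vector_derivative[symmetric])
  then have "wallis 1 = 2"
    by (simp add: wallis_def integral_unique)
  moreover have "wallis 0 = pi"
    by (simp add: wallis_def)
  ultimately show ?case by simp
next
  case (Suc n)
  have "real (n + 2) * (wallis (Suc n) * wallis (Suc (Suc n)))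
      = real (n + 1) * (wallis n * wallis (Suc n))"
    using wallis_recurrence[of n] by (simp add: algebra_simps)
  also have "\<dots> = 2 * pi"
    by (simp add: Suc.IH)
  finally show ?case by (simp add: field_simps)
qed

text \<open>
  This is Archimedes' theorem that a coordinate of a uniformly distributed point of the
  sphere is uniformly distributed: in polar coordinates \<open>sin t * sin s\<close> is the coordinate,
  \<open>sin t\<close> the surface density, and the parameters run over the half of the sphere on which
  the coordinate is nonnegative. For monomials it is the product formula above, so for
  polynomials no surface integral is needed.
\<close>
lemma polynomial_double_sine_integral:
  fixes q :: "real \<Rightarrow> real"
  assumes "real_polynomial_function q" "0 \<le> a"
  shows "a * integral {0..pi} (\<lambda>t. sin t * integral {0..pi} (\<lambda>s. q (a * sin t * sin s)))
    = 2 * pi * integral {0..a} q"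
proof -
  obtain c n where q: "q = (\<lambda>x. \<Sum>i\<le>n. c i * x ^ i)"
    using assms(1) unfolding real_polynomial_function_iff_sum by blast
  have inner: "integral {0..pi} (\<lambda>s. q (x * sin s)) = (\<Sum>i\<le>n. c i * wallis i * x ^ i)" for x
  proof -
    have "(\<lambda>s. q (x * sin s)) = (\<lambda>s. \<Sum>i\<le>n. (c i * x ^ i) * sin s ^ i)"
      by (simp add: q power_mult_distrib mult_ac)
    moreover have "integral {0..pi} (\<lambda>s. \<Sum>i\<le>n. (c i * x ^ i) * sin s ^ i)
        = (\<Sum>i\<le>n. (c i * x ^ i) * wallis i)"
      unfolding wallis_def
      by (subst integral_sum) (auto intro!: integrable_on_cont continuous_intros)
    ultimately show ?thesis by (simp add: mult_ac)
  qed
  have "integral {0..pi} (\<lambda>t. sin t * integral {0..pi} (\<lambda>s. q (a * sin t * sin s)))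
     = integral {0..pi} (\<lambda>t. \<Sum>i\<le>n. (c i * wallis i * a ^ i) * sin t ^ Suc i)"
    unfolding inner by (simp add: sum_distrib_left power_mult_distrib mult_ac)
  also have "\<dots> = (\<Sum>i\<le>n. (c i * wallis i * a ^ i) * wallis (Suc i))"
    unfolding wallis_def[of "Suc _"]
    by (subst integral_sum) (auto intro!: integrable_on_cont continuous_intros simp del: power_Suc)
  also have "\<dots> = (\<Sum>i\<le>n. c i * a ^ i * (wallis i * wallis (Suc i)))"
    by (simp add: mult_ac)
  also have "a * \<dots> = 2 * pi * (\<Sum>i\<le>n. c i * (a ^ Suc i / real (Suc i)))"
    unfolding wallis_product by (simp add: sum_distrib_left mult_ac)
  also have "(\<Sum>i\<le>n. c i * (a ^ Suc i / real (Suc i))) = integral {0..a} q"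
  proof (rule integral_unique[symmetric])
    have "(q has_integral (\<Sum>i\<le>n. c i * (a ^ Suc i / real (Suc i)))
        - (\<Sum>i\<le>n. c i * (0 ^ Suc i / real (Suc i)))) {0..a}"
    proof (rule fundamental_theorem_of_calculus[OF assms(2)])
      fix x :: real
      have "((\<lambda>x. \<Sum>i\<le>n. c i * (x ^ Suc i / real (Suc i))) has_real_derivative
          (\<Sum>i\<le>n. c i * (real (Suc i) * x ^ i / real (Suc i)))) (at x within {0..a})"
        by ((rule derivative_eq_intros refl | simp)+, simp add: mult.commute)
      then show "((\<lambda>x. \<Sum>i\<le>n. c i * (x ^ Suc i / real (Suc i))) has_vector_derivative q x)
          (at x within {0..a})"
        by (simp add: q has_real_derivative_iff_has_vector_derivative del: of_nat_Suc)
    qed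
    then show "(q has_integral (\<Sum>i\<le>n. c i * (a ^ Suc i / real (Suc i)))) {0..a}"
      by simp
  qed
  finally show ?thesis .
qed

text \<open>
  Averaging the hypothesis once more with weight \<open>sin t\<close> at the scales \<open>a * sin t\<close> turns the
  Abel-type integral into the plain integral of \<open>\<Psi>\<close> over \<open>[0, a]\<close>. The identity behind this is
  available for polynomials and passes to \<open>\<Psi>\<close> by uniform approximation, because both sides are
  bounded by a multiple of the supremum norm.
\<close>
lemma abel_sine_injective:
  fixes \<Psi> :: "real \<Rightarrow> real"
  assumes cont: "continuous_on {0..1} \<Psi>"
    and zero: "\<And>a. a \<in> {0..1} \<Longrightarrow> integral {0..pi} (\<lambda>s. \<Psi> (a * sin s)) = 0"
  shows "\<Psi> 1 = 0"
proof -
  have int_zero: "integral {0..a} \<Psi> = 0" if a: "a \<in> {0..1}" for a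
  proof -
    have "\<bar>integral {0..a} \<Psi>\<bar> \<le> e * (pi + 1)" if e: "e > 0" for e
    proof -
      obtain q where q: "real_polynomial_function q" "\<And>x. x \<in> {0..1} \<Longrightarrow> \<bar>\<Psi> x - q x\<bar> < e"
        using Stone_Weierstrass_real_polynomial_function[OF _ cont e] by auto
      have contq: "continuous_on S q" for S
        using q(1) by (simp add: continuous_on_polymonial_function real_polynomial_function_eq)
      have inner: "\<bar>integral {0..pi} (\<lambda>s. q (x * sin s))\<bar> \<le> e * pi" if x: "x \<in> {0..1}" for x
      proof -
        have r: "x * sin s \<in> {0..1}" if "s \<in> {0..pi}" for s
          using x that sin_ge_zero[of s] mult_le_one[of x "sin s"] by auto
        have c1: "continuous_on {0..pi} (\<lambda>s. q (x * sin s))"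
          by (rule continuous_on_compose2[OF contq[of UNIV]]) (auto intro!: continuous_intros)
        have c2: "continuous_on {0..pi} (\<lambda>s. \<Psi> (x * sin s))"
          by (rule continuous_on_compose2[OF cont]) (use r in \<open>auto intro!: continuous_intros\<close>)
        have "integral {0..pi} (\<lambda>s. q (x * sin s))
            = integral {0..pi} (\<lambda>s. q (x * sin s) - \<Psi> (x * sin s))"
          using zero[OF x] c1 c2 by (subst integral_diff) (auto intro: integrable_continuous_real)
        also have "norm \<dots> \<le> e * (pi - 0)"
          by (rule integral_bound)
            (use q(2) r in \<open>auto intro!: continuous_on_diff c1 c2 less_imp_le simp: abs_minus_commute\<close>)
        finally show ?thesis by simp
      qed
      have "\<bar>a * integral {0..pi} (\<lambda>t. sin t * integral {0..pi} (\<lambda>s. q (a * sin t * sin s)))\<bar>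
          \<le> 1 * (e * pi * (pi - 0))"
        unfolding abs_mult
      proof (rule mult_mono)
        have "continuous_on (UNIV \<times> cbox 0 pi) (\<lambda>(x, s). q (x * sin s))"
          unfolding split_beta
          by (rule continuous_on_compose2[OF contq[of UNIV]]) (auto intro!: continuous_intros)
        then have "continuous_on UNIV (\<lambda>x. integral {0..pi} (\<lambda>s. q (x * sin s)))"
          using integral_continuous_on_param[of UNIV 0 pi "\<lambda>x s. q (x * sin s)"] by simp
        then have c: "continuous_on {0..pi} (\<lambda>t. integral {0..pi} (\<lambda>s. q (a * sin t * sin s)))"
          by (rule continuous_on_compose2) (auto intro!: continuous_intros)
        have "norm (integral {0..pi} (\<lambda>t. sin t * integral {0..pi} (\<lambda>s. q (a * sin t * sin s))))
          \<le> e * pi * (pi - 0)"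
        proof (rule integral_bound)
          fix t :: real assume t: "t \<in> {0..pi}"
          have "a * sin t \<in> {0..1}"
            using a t sin_ge_zero[of t] mult_le_one[of a "sin t"] by auto
          then have "\<bar>integral {0..pi} (\<lambda>s. q (a * sin t * sin s))\<bar> \<le> e * pi"
            by (rule inner)
          then have "\<bar>sin t\<bar> * \<bar>integral {0..pi} (\<lambda>s. q (a * sin t * sin s))\<bar> \<le> 1 * (e * pi)"
            by (intro mult_mono) auto
          then show "norm (sin t * integral {0..pi} (\<lambda>s. q (a * sin t * sin s))) \<le> e * pi"
            by (simp add: abs_mult)
        qed (auto intro!: continuous_intros c)
        then show "\<bar>integral {0..pi} (\<lambda>t. sin t * integral {0..pi} (\<lambda>s. q (a * sin t * sin s)))\<bar>
          \<le> e * pi * (pi - 0)" by simp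
      qed (use a in auto)
      then have "\<bar>2 * pi * integral {0..a} q\<bar> \<le> e * pi * pi"
        using polynomial_double_sine_integral[OF q(1)] a by simp
      then have "pi * (2 * \<bar>integral {0..a} q\<bar>) \<le> pi * (e * pi)"
        by (simp add: abs_mult mult_ac)
      then have "2 * \<bar>integral {0..a} q\<bar> \<le> e * pi"
        by (simp add: mult_le_cancel_left)
      moreover have "\<bar>integral {0..a} \<Psi> - integral {0..a} q\<bar> \<le> e * (a - 0)"
      proof -
        have c: "continuous_on {0..a} \<Psi>"
          using cont by (rule continuous_on_subset) (use a in auto)
        have "norm (integral {0..a} (\<lambda>x. \<Psi> x - q x)) \<le> e * (a - 0)"
          by (rule integral_bound)
            (use a q(2) in \<open>auto intro!: continuous_on_diff c contq less_imp_le\<close>)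
        then show ?thesis
          using c contq by (simp add: integral_diff integrable_continuous_real)
      qed
      moreover have "e * (a - 0) \<le> e"
        using a e by (simp add: mult_le_cancel_left1)
      moreover have "e * (pi + 1) = e * pi + e" "e * pi > 0"
        using e by (auto simp: algebra_simps)
      ultimately show ?thesis by linarith
    qed
    from this[of "e / (pi + 1)" for e] have "\<bar>integral {0..a} \<Psi>\<bar> \<le> 0 + e" if "e > 0" for e
      using that pi_gt_zero add_pos_pos[OF pi_gt_zero zero_less_one] by simp
    then have "\<bar>integral {0..a} \<Psi>\<bar> \<le> 0"
      by (rule field_le_epsilon)
    then show ?thesis by simp
  qed
  have "((\<lambda>x. integral {0..x} \<Psi>) has_vector_derivative \<Psi> 1) (at 1 within {0..1})"
    by (rule integral_has_vector_derivative[OF cont]) simp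
  moreover have "((\<lambda>x. integral {0..x} \<Psi>) has_vector_derivative 0) (at 1 within {0..1})"
    by (rule has_vector_derivative_transform[of _ _ _ "\<lambda>_. 0"]) (use int_zero in auto)
  ultimately show ?thesis
    by (rule vector_derivative_unique_within[rotated])
      (simp add: at_within_Icc_at_left)
qed

section \<open>Rotations about an axis\<close>

text \<open>
  Rodrigues' formula without its component along the axis: for a unit vector \<open>\<xi>\<close> it is the
  rotation about \<open>\<xi>\<close> by the angle \<open>t\<close> on the vectors perpendicular to \<open>\<xi>\<close>, the only ones
  to which it is applied as a rotation.
\<close>
definition rot :: "real^3 \<Rightarrow> real \<Rightarrow> real^3 \<Rightarrow> real^3" where
  "rot \<xi> t x = cos t *\<^sub>R x + sin t *\<^sub>R cross3 \<xi> x"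

lemma cross_cross_same: "cross3 (cross3 x y) x = (x \<bullet> x) *\<^sub>R y - (x \<bullet> y) *\<^sub>R x"
  using Lagrange[of x x y] by (metis cross_skew minus_diff_eq)

lemma cross_cross_perp:
  assumes "norm \<xi> = 1" "x \<bullet> \<xi> = 0"
  shows "cross3 \<xi> (cross3 \<xi> x) = - x"
  using assms by (simp add: Lagrange norm_eq_1 inner_commute)

lemma norm_cross_perp:
  assumes "x \<bullet> \<xi> = 0"
  shows "norm (cross3 \<xi> x) = norm \<xi> * norm x"
proof -
  have "(norm (cross3 \<xi> x))\<^sup>2 = (norm \<xi> * norm x)\<^sup>2"
    using norm_cross_dot[of \<xi> x] assms by (simp add: inner_commute)
  then show ?thesis
    by (metis norm_ge_zero mult_nonneg_nonneg power2_eq_imp_eq)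
qed

lemma rot_perp: "x \<bullet> \<xi> = 0 \<Longrightarrow> rot \<xi> t x \<bullet> \<xi> = 0"
  by (simp add: rot_def inner_left_distrib dot_cross_self)

lemma rot_rot:
  assumes "norm \<xi> = 1" "x \<bullet> \<xi> = 0"
  shows "rot \<xi> a (rot \<xi> b x) = rot \<xi> (a + b) x"
proof -
  have "rot \<xi> a (rot \<xi> b x)
    = cos a *\<^sub>R (cos b *\<^sub>R x + sin b *\<^sub>R cross3 \<xi> x) + sin a *\<^sub>R (cos b *\<^sub>R cross3 \<xi> x - sin b *\<^sub>R x)"
    using cross_cross_perp[OF assms] by (simp add: rot_def cross_add_right cross_mult_right)
  then show ?thesis
    by (simp add: rot_def cos_add sin_add algebra_simps)
qed

lemma inner_rot:
  assumes "norm \<xi> = 1" "x \<bullet> \<xi> = 0" "y \<bullet> \<xi> = 0"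
  shows "rot \<xi> t x \<bullet> rot \<xi> t y = x \<bullet> y"
proof -
  have a: "cross3 \<xi> x \<bullet> cross3 \<xi> y = x \<bullet> y"
    by (metis assms(1,3) cross_cross_perp cross_skew cross_triple inner_commute minus_minus)
  have b: "x \<bullet> cross3 \<xi> y = - (cross3 \<xi> x \<bullet> y)"
    by (metis cross_skew cross_triple inner_commute inner_minus_left)
  have "rot \<xi> t x \<bullet> rot \<xi> t y = cos t * (cos t * (x \<bullet> y)) + sin t * (sin t * (x \<bullet> y))"
    by (simp add: rot_def inner_left_distrib inner_right_distrib a b algebra_simps)
  also have "\<dots> = (cos t * cos t + sin t * sin t) * (x \<bullet> y)"
    by (simp only: distrib_right mult.assoc)
  finally show ?thesis by simp
qed

lemma norm_rot:
  assumes "norm \<xi> = 1" "x \<bullet> \<xi> = 0"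
  shows "norm (rot \<xi> t x) = norm x"
  using inner_rot[OF assms assms(2)] by (simp add: norm_eq_sqrt_inner)

lemma rot_0 [simp]: "rot \<xi> 0 x = x"
  and rot_minus: "rot \<xi> t (- x) = - rot \<xi> t x"
  and rot_add_pi: "rot \<xi> (t + pi) x = - rot \<xi> t x"
  and rot_add_2pi: "rot \<xi> (t + 2 * pi) x = rot \<xi> t x"
  by (simp_all add: rot_def)

lemma continuous_on_rot [continuous_intros]:
  fixes \<xi> x :: "'a::t2_space \<Rightarrow> real^3"
  assumes "continuous_on S \<xi>" "continuous_on S t" "continuous_on S x"
  shows "continuous_on S (\<lambda>y. rot (\<xi> y) (t y) (x y))"
  unfolding rot_def using assms by (intro continuous_intros continuous_on_cross)

lemma unit_perp_exists: 
  fixes p :: "real^3"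
  obtains u where "norm u = 1" "u \<bullet> p = 0"
proof -
  obtain y where y: "y \<noteq> 0" "orthogonal p y"
    using orthogonal_to_vector_exists[of p] by auto
  show thesis
    by (rule that[of "y /\<^sub>R norm y"]) (use y in \<open>auto simp: orthogonal_def inner_commute\<close>)
qed

section \<open>Great circle integrals determine the even part of a function\<close>

text \<open>
  Averaging \<open>F\<close> over the rotations about \<open>p\<close> leaves a function \<open>\<Phi>\<close> of the height \<open>z\<close> above
  the equator. Rotating a great circle about \<open>p\<close> and exchanging the two integrals shows that
  \<open>\<Phi>\<close> integrates to zero along every great circle, where the height is \<open>a * sin s\<close> if \<open>a\<close> is
  the maximal height. This is the Abel equation for the even part of \<open>\<Phi>\<close>, whose value at
  height \<open>1\<close> is, up to a factor, \<open>F p + F (- p)\<close>.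
\<close>
theorem Funk_injective:
  fixes F :: "real^3 \<Rightarrow> real"
  assumes cont: "continuous_on (sphere 0 1) F"
    and zero: "\<And>\<xi> u. norm \<xi> = 1 \<Longrightarrow> norm u = 1 \<Longrightarrow> u \<bullet> \<xi> = 0 \<Longrightarrow>
      integral {0..2 * pi} (\<lambda>t. F (rot \<xi> t u)) = 0"
    and p: "norm p = 1"
  shows "F p + F (- p) = 0"
proof -
  obtain u where u: "norm u = 1" "u \<bullet> p = 0"
    by (rule unit_perp_exists)
  define W where "W = (\<lambda>\<tau>. rot p \<tau> u)"
  define V where "V = (\<lambda>\<tau>. cross3 p (W \<tau>))"
  have W: "norm (W \<tau>) = 1" "W \<tau> \<bullet> p = 0" for \<tau>
    using u p by (auto simp: W_def norm_rot rot_perp)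
  have V: "norm (V \<tau>) = 1" "V \<tau> \<bullet> p = 0" "V \<tau> \<bullet> W \<tau> = 0" for \<tau>
    using W[of \<tau>] p by (auto simp: V_def norm_cross_perp dot_cross_self)
  have contW: "continuous_on S W" for S
    unfolding W_def by (intro continuous_intros)
  have contV: "continuous_on S V" for S
    unfolding V_def by (intro continuous_intros continuous_on_cross contW)
  have norm_comb: "norm (b *\<^sub>R x + a *\<^sub>R y) = 1"
    if "norm x = 1" "norm y = 1" "x \<bullet> y = 0" "b\<^sup>2 + a\<^sup>2 = 1" for a b and x y :: "real^3"
    using that by (simp add: norm_eq_1 inner_left_distrib inner_right_distrib inner_commute
        power2_eq_square)
  define \<Phi> where "\<Phi> = (\<lambda>z. integral {0..2 * pi} (\<lambda>\<tau>. F (sqrt (1 - z\<^sup>2) *\<^sub>R W \<tau> + z *\<^sub>R p)))"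
  have sq: "(sqrt (1 - z\<^sup>2))\<^sup>2 + z\<^sup>2 = 1" if "z \<in> {-1..1}" for z :: real
    using that by (simp add: abs_square_le_1 abs_le_iff)
  have range: "a * sin s \<in> {-1..1}" if "a \<in> {0..1}" for a s :: real
  proof -
    have "\<bar>a * sin s\<bar> \<le> 1"
      unfolding abs_mult by (rule mult_le_one) (use that in auto)
    then show ?thesis
      by (auto simp: abs_le_iff)
  qed
  have cont\<Phi>: "continuous_on {-1..1} \<Phi>"
  proof -
    have "continuous_on ({-1..1} \<times> cbox 0 (2 * pi)) (\<lambda>(z, \<tau>). F (sqrt (1 - z\<^sup>2) *\<^sub>R W \<tau> + z *\<^sub>R p))"
      unfolding split_beta
    proof (rule continuous_on_compose2[OF cont])
      show "continuous_on ({-1..1} \<times> cbox 0 (2 * pi)) (\<lambda>x. sqrt (1 - (fst x)\<^sup>2) *\<^sub>R W (snd x) + fst x *\<^sub>R p)"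
        by (intro continuous_intros continuous_on_compose2[OF contW[of UNIV]]) auto
    qed (use norm_comb[OF W(1) p W(2) sq] in auto)
    then show ?thesis
      unfolding \<Phi>_def using integral_continuous_on_param[of "{-1..1}" 0 "2 * pi"] by simp
  qed
  have circle: "integral {0..2 * pi} (\<lambda>s. \<Phi> (a * sin s)) = 0" if a: "a \<in> {0..1}" for a
  proof -
    define b where "b = sqrt (1 - a\<^sup>2)"
    have ab: "b\<^sup>2 + a\<^sup>2 = 1"
      using sq[of a] a by (simp add: b_def)
    \<comment> \<open>The orthonormal pair \<open>V \<tau>, y \<tau>\<close> spans the great circle of maximal height \<open>a\<close> that
       attains this height above the direction \<open>W \<tau>\<close>.\<close>
    define y where "y = (\<lambda>\<tau>. b *\<^sub>R W \<tau> + a *\<^sub>R p)"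
    have y: "norm (y \<tau>) = 1" "y \<tau> \<bullet> V \<tau> = 0" "V \<tau> \<bullet> y \<tau> = 0" for \<tau>
      using norm_comb[OF W(1) p W(2) ab] V(2,3)
      by (auto simp: y_def inner_left_distrib inner_right_distrib inner_commute)
    have point: "norm (cos s *\<^sub>R V \<tau> + sin s *\<^sub>R y \<tau>) = 1" for s \<tau>
      by (rule norm_comb) (use V y in auto)
    have great: "integral {0..2 * pi} (\<lambda>s. F (cos s *\<^sub>R V \<tau> + sin s *\<^sub>R y \<tau>)) = 0" for \<tau>
    proof -
      have "norm (cross3 (V \<tau>) (y \<tau>)) = 1"
        using y V by (simp add: norm_cross_perp)
      moreover have "rot (cross3 (V \<tau>) (y \<tau>)) s (V \<tau>) = cos s *\<^sub>R V \<tau> + sin s *\<^sub>R y \<tau>" for s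
        using y(3)[of \<tau>] V(1)[of \<tau>] by (simp add: rot_def cross_cross_same norm_eq_1)
      ultimately show ?thesis
        using zero[of "cross3 (V \<tau>) (y \<tau>)" "V \<tau>"] V(1) by (simp add: dot_cross_self)
    qed
    \<comment> \<open>For fixed \<open>s\<close> the points run through the parallel at height \<open>a * sin s\<close>, with a
       phase \<open>\<kappa>\<close> that does not affect the integral over the whole parallel.\<close>
    have parallel: "integral {0..2 * pi} (\<lambda>\<tau>. F (cos s *\<^sub>R V \<tau> + sin s *\<^sub>R y \<tau>)) = \<Phi> (a * sin s)" for s
    proof -
      define z where "z = a * sin s"
      define \<rho> where "\<rho> = sqrt (1 - z\<^sup>2)"
      have z: "z \<in> {-1..1}"
        unfolding z_def by (rule range[OF a])
      have r: "\<rho>\<^sup>2 = (b * sin s)\<^sup>2 + (cos s)\<^sup>2"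
      proof -
        have "(b * sin s)\<^sup>2 + (cos s)\<^sup>2 = (b\<^sup>2 + a\<^sup>2) * (sin s)\<^sup>2 - z\<^sup>2 + (cos s)\<^sup>2"
          by (simp add: z_def power_mult_distrib algebra_simps)
        then show ?thesis
          using sq[OF z] sin_cos_squared_add[of s] unfolding ab \<rho>_def by linarith
      qed
      have "\<exists>\<kappa>. b * sin s = \<rho> * cos \<kappa> \<and> cos s = \<rho> * sin \<kappa>"
      proof (cases "\<rho> = 0")
        case True
        then show ?thesis using r by (simp add: sum_power2_eq_zero_iff)
      next
        case False
        then have "(b * sin s / \<rho>)\<^sup>2 + (cos s / \<rho>)\<^sup>2 = 1"
          unfolding power_divide add_divide_distrib[symmetric] r[symmetric] by simp
        then obtain \<kappa> where "b * sin s / \<rho> = cos \<kappa>" "cos s / \<rho> = sin \<kappa>"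
          by (rule sincos_total_2pi)
        with False show ?thesis
          by (auto simp: field_simps)
      qed
      then obtain \<kappa> where \<kappa>: "b * sin s = \<rho> * cos \<kappa>" "cos s = \<rho> * sin \<kappa>" by blast
      have "cos s *\<^sub>R V \<tau> + sin s *\<^sub>R y \<tau> = \<rho> *\<^sub>R W (\<tau> + \<kappa>) + z *\<^sub>R p" for \<tau>
      proof -
        have "W (\<tau> + \<kappa>) = rot p \<kappa> (W \<tau>)"
          unfolding W_def using u p by (simp add: rot_rot add.commute)
        also have "\<dots> = cos \<kappa> *\<^sub>R W \<tau> + sin \<kappa> *\<^sub>R V \<tau>"
          by (simp add: rot_def V_def)
        finally show ?thesis
          using \<kappa> by (simp add: y_def z_def algebra_simps)
      qed
      then have "integral {0..2 * pi} (\<lambda>\<tau>. F (cos s *\<^sub>R V \<tau> + sin s *\<^sub>R y \<tau>))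
          = integral {0..2 * pi} (\<lambda>\<tau>. F (\<rho> *\<^sub>R W (\<tau> + \<kappa>) + z *\<^sub>R p))"
        by simp
      also have "\<dots> = integral {0..2 * pi} (\<lambda>\<tau>. F (\<rho> *\<^sub>R W \<tau> + z *\<^sub>R p))"
      proof (rule integral_periodic_shift)
        show "continuous_on UNIV (\<lambda>\<tau>. F (\<rho> *\<^sub>R W \<tau> + z *\<^sub>R p))"
          by (rule continuous_on_compose2[OF cont])
            (use norm_comb[OF W(1) p W(2) sq[OF z]] in
              \<open>auto simp: \<rho>_def intro!: continuous_intros contW\<close>)
      qed (auto simp: W_def rot_add_2pi)
      also have "\<dots> = \<Phi> (a * sin s)"
        by (simp add: \<Phi>_def \<rho>_def z_def)
      finally show ?thesis .
    qed
    have "continuous_on (cbox (0, 0) (2 * pi, 2 * pi)) (\<lambda>(s, \<tau>). F (cos s *\<^sub>R V \<tau> + sin s *\<^sub>R y \<tau>))"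
      unfolding split_beta
    proof (rule continuous_on_compose2[OF cont])
      show "continuous_on (cbox (0, 0) (2 * pi, 2 * pi))
        (\<lambda>x. cos (fst x) *\<^sub>R V (snd x) + sin (fst x) *\<^sub>R y (snd x))"
        unfolding y_def
        by (intro continuous_intros continuous_on_compose2[OF contW[of UNIV]]
            continuous_on_compose2[OF contV[of UNIV]]) auto
    qed (use point in auto)
    from integral_swap_continuous[OF this]
    have "integral {0..2 * pi} (\<lambda>s. integral {0..2 * pi} (\<lambda>\<tau>. F (cos s *\<^sub>R V \<tau> + sin s *\<^sub>R y \<tau>)))
      = integral {0..2 * pi} (\<lambda>\<tau>. integral {0..2 * pi} (\<lambda>s. F (cos s *\<^sub>R V \<tau> + sin s *\<^sub>R y \<tau>)))"
      by simp
    then show ?thesis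
      unfolding parallel great by simp
  qed
  define \<Psi> where "\<Psi> = (\<lambda>z. \<Phi> z + \<Phi> (- z))"
  have "\<Psi> 1 = 0"
  proof (rule abel_sine_injective)
    show "continuous_on {0..1} \<Psi>"
      unfolding \<Psi>_def
      by (intro continuous_intros continuous_on_compose2[OF cont\<Phi>]) auto
  next
    fix a :: real assume a: "a \<in> {0..1}"
    have c: "continuous_on UNIV (\<lambda>s. \<Phi> (a * sin s))"
      by (rule continuous_on_compose2[OF cont\<Phi>]) (use range[OF a] in \<open>auto intro!: continuous_intros\<close>)
    have c': "continuous_on UNIV (\<lambda>s. \<Phi> (- (a * sin s)))"
      by (rule continuous_on_compose2[OF cont\<Phi>])
        (use range[OF a] in \<open>auto intro!: continuous_intros simp: minus_le_iff\<close>)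
    have "integral {0..pi} (\<lambda>s. \<Psi> (a * sin s))
        = integral {0..pi} (\<lambda>s. \<Phi> (a * sin s)) + integral {0..pi} (\<lambda>s. \<Phi> (- (a * sin s)))"
      unfolding \<Psi>_def by (rule integral_add) (intro integrable_on_cont c c')+
    also have "integral {0..pi} (\<lambda>s. \<Phi> (- (a * sin s)))
        = integral {0..pi} ((\<lambda>s. \<Phi> (a * sin s)) \<circ> (+) pi)"
      by (simp add: o_def)
    also have "\<dots> = integral {pi..2 * pi} (\<lambda>s. \<Phi> (a * sin s))"
      by (simp only: integral_shift_Icc_real) simp
    also have "integral {0..pi} (\<lambda>s. \<Phi> (a * sin s)) + \<dots> = integral {0..2 * pi} (\<lambda>s. \<Phi> (a * sin s))"
      by (rule Henstock_Kurzweil_Integration.integral_combine) (auto intro!: integrable_on_cont c)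
    also have "\<dots> = 0"
      by (rule circle[OF a])
    finally show "integral {0..pi} (\<lambda>s. \<Psi> (a * sin s)) = 0" .
  qed
  then show ?thesis
    by (simp add: \<Psi>_def \<Phi>_def flip: distrib_left)
qed

section \<open>Consequences of equality up to rotation on one plane\<close>

text \<open>
  A rotation of the circle does not change the integral of a function over it, so the
  difference of the \<open>n\<close>-th powers satisfies the hypothesis of \<open>Funk_injective\<close>. The cases
  \<open>n = 1\<close> and \<open>n = 2\<close> determine the unordered pair of values at \<open>x\<close> and \<open>- x\<close>.
\<close>
lemma power_sums_agree:
  fixes f g :: "real^3 \<Rightarrow> real"
  assumes cf: "continuous_on UNIV f" and cg: "continuous_on UNIV g"
    and turn: "\<And>\<xi>. norm \<xi> = 1 \<Longrightarrow> \<exists>\<alpha>. \<forall>x. x \<bullet> \<xi> = 0 \<longrightarrow> f (rot \<xi> \<alpha> x) = g x"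
    and x: "norm x = 1"
  shows "f x ^ n + f (- x) ^ n = g x ^ n + g (- x) ^ n"
proof -
  have "(\<lambda>x. f x ^ n - g x ^ n) x + (\<lambda>x. f x ^ n - g x ^ n) (- x) = 0"
  proof (rule Funk_injective[OF _ _ x])
    show "continuous_on (sphere 0 1) (\<lambda>x. f x ^ n - g x ^ n)"
      by (intro continuous_intros continuous_on_subset[OF cf] continuous_on_subset[OF cg]) auto
  next
    fix \<xi> u :: "real^3" assume \<xi>: "norm \<xi> = 1" and u: "norm u = 1" "u \<bullet> \<xi> = 0"
    obtain \<alpha> where \<alpha>: "\<And>x. x \<bullet> \<xi> = 0 \<Longrightarrow> f (rot \<xi> \<alpha> x) = g x"
      using turn[OF \<xi>] by blast
    define h where "h = (\<lambda>t. f (rot \<xi> t u) ^ n)"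
    have g: "g (rot \<xi> t u) ^ n = h (t + \<alpha>)" for t
      using \<alpha>[OF rot_perp[OF u(2), of t]] rot_rot[OF \<xi> u(2), of \<alpha> t] by (simp add: h_def add.commute)
    have cont: "continuous_on UNIV h"
      unfolding h_def
      by (intro continuous_intros continuous_on_compose2[OF cf]) auto
    then have cont': "continuous_on UNIV (\<lambda>t. h (t + \<alpha>))"
      by (rule continuous_on_compose2) (auto intro!: continuous_intros)
    have "integral {0..2 * pi} (\<lambda>t. h (t + \<alpha>)) = integral {0..2 * pi} h"
      by (rule integral_periodic_shift[OF cont]) (auto simp: h_def rot_add_2pi)
    then have "integral {0..2 * pi} (\<lambda>t. h t - h (t + \<alpha>)) = 0"
      by (subst integral_diff) (auto intro: integrable_on_cont cont cont')
    then show "integral {0..2 * pi} (\<lambda>t. f (rot \<xi> t u) ^ n - g (rot \<xi> t u) ^ n) = 0"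
      by (simp add: g) (simp add: h_def)
  qed
  then show ?thesis by simp
qed

text \<open>
  The periods generate a dense group, by Kronecker's approximation theorem.
\<close>
lemma incommensurable_periods_constant:
  fixes h :: "real \<Rightarrow> real"
  assumes cont: "continuous_on UNIV h" and T: "T > 0"
    and per: "\<And>t. h (t + T) = h t" "\<And>t. h (t + \<alpha>) = h t"
    and irr: "\<alpha> / T \<notin> \<rat>"
  shows "h t = h 0"
proof (rule ccontr)
  assume "h t \<noteq> h 0"
  then obtain \<delta> where \<delta>: "\<delta> > 0" "\<And>s. \<bar>s - t\<bar> < \<delta> \<Longrightarrow> \<bar>h s - h t\<bar> < \<bar>h 0 - h t\<bar>"
    using cont[unfolded continuous_on_iff, rule_format, of t "\<bar>h 0 - h t\<bar>"]
    by (auto simp: dist_real_def)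
  obtain m k :: int where "\<bar>of_int k * (\<alpha> / T) - of_int m - t / T\<bar> < \<delta> / T"
    using sequence_of_fractional_parts_is_dense[OF irr, of "\<delta> / T" "t / T"] \<delta> T
    by (metis divide_pos_pos)
  moreover have "of_int k * (\<alpha> / T) - of_int m - t / T = (of_int k * \<alpha> - of_int m * T - t) / T"
    using T by (simp add: field_simps)
  ultimately have "\<bar>of_int k * \<alpha> - of_int m * T - t\<bar> < \<delta>"
    using T by (simp add: abs_divide divide_less_cancel)
  moreover have "h (of_int k * \<alpha> - of_int m * T) = h 0"
    using periodic_shift_int[of h T "of_int k * \<alpha> - of_int m * T" m]
      periodic_shift_int[of h \<alpha> 0 k] per by simp
  ultimately show False
    using \<delta>(2) by fastforce
qed

text \<open>
  The sum and the sum of squares of the values of \<open>f\<close> at a point and its antipode are the same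
  for \<open>f\<close> and \<open>g\<close>, hence invariant under the rotation, hence constant on the circle. So the
  difference of \<open>f\<close> at antipodal points has constant modulus, and it changes sign along a half
  circle. Therefore it vanishes, and \<open>f\<close> is half of a constant sum.
\<close>
lemma irrational_turn:
  fixes f g :: "real^3 \<Rightarrow> real"
  assumes cf: "continuous_on UNIV f"
    and sums: "\<And>x n. norm x = 1 \<Longrightarrow> f x ^ n + f (- x) ^ n = g x ^ n + g (- x) ^ n"
    and \<xi>: "norm \<xi> = 1" and turn: "\<And>x. x \<bullet> \<xi> = 0 \<Longrightarrow> f (rot \<xi> \<alpha> x) = g x"
    and irr: "\<alpha> / (2 * pi) \<notin> \<rat>" and u: "norm u = 1" "u \<bullet> \<xi> = 0"
  shows "f u = g u"
proof -
  define F where "F = (\<lambda>t. f (rot \<xi> t u))"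
  have contF: "continuous_on UNIV F"
    unfolding F_def by (intro continuous_intros continuous_on_compose2[OF cf]) auto
  then have contF': "continuous_on UNIV (\<lambda>t. F (t + pi))"
    by (rule continuous_on_compose2) (auto intro!: continuous_intros)
  have const: "F t ^ n + F (t + pi) ^ n = F 0 ^ n + F (0 + pi) ^ n" for t n
  proof (rule incommensurable_periods_constant[OF _ _ _ _ irr])
    show "continuous_on UNIV (\<lambda>t. F t ^ n + F (t + pi) ^ n)"
      by (intro continuous_intros contF contF')
    show "F (t + 2 * pi) ^ n + F (t + 2 * pi + pi) ^ n = F t ^ n + F (t + pi) ^ n" for t
      unfolding F_def using rot_add_2pi[of \<xi> "t + pi" u] rot_add_2pi[of \<xi> t u]
      by (simp only: add.assoc add.commute[of "2 * pi" pi])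
    show "F (t + \<alpha>) ^ n + F (t + \<alpha> + pi) ^ n = F t ^ n + F (t + pi) ^ n" for t
    proof -
      have "rot \<xi> (t + \<alpha>) u = rot \<xi> \<alpha> (rot \<xi> t u)"
        by (simp add: rot_rot[OF \<xi> u(2)] add.commute)
      then have "F (t + \<alpha>) ^ n + F (t + \<alpha> + pi) ^ n = g (rot \<xi> t u) ^ n + g (- rot \<xi> t u) ^ n"
        using turn[of "rot \<xi> t u"] turn[of "- rot \<xi> t u"] rot_perp[OF u(2), of t]
        unfolding F_def rot_add_pi by (simp add: rot_minus)
      then show ?thesis
        using sums[of "rot \<xi> t u" n] norm_rot[OF \<xi> u(2)] u by (simp add: F_def rot_add_pi)
    qed
  qed simp
  \<comment> \<open>\<open>(p - q)\<^sup>2 = 2 (p\<^sup>2 + q\<^sup>2) - (p + q)\<^sup>2\<close>, a function of the two constant power sums\<close>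
  have sq: "(F t - F (t + pi))\<^sup>2 = (F 0 - F pi)\<^sup>2" for t
  proof -
    have "(F t - F (t + pi))\<^sup>2 = 2 * (F t ^ 2 + F (t + pi) ^ 2) - (F t ^ 1 + F (t + pi) ^ 1) ^ 2" for t
      by (simp add: power2_eq_square algebra_simps)
    then show ?thesis
      using const[of t 2] const[of t 1] by (metis add_0)
  qed
  have "F (pi + pi) = F 0"
    using rot_add_2pi[of \<xi> 0 u] by (simp add: F_def)
  moreover have "continuous_on {0..pi} (\<lambda>t. F t - F (t + pi))"
    by (rule continuous_on_subset[OF continuous_on_diff[OF contF contF']]) simp
  ultimately have "\<exists>t. F t - F (t + pi) = 0"
    using IVT'[of "\<lambda>t. F t - F (t + pi)" 0 0 pi] IVT2'[of "\<lambda>t. F t - F (t + pi)" pi 0 0]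
    by (cases "F 0 \<le> F pi") auto
  then obtain t where "F t - F (t + pi) = 0" by blast
  with sq[of t] have "F 0 = F pi" by simp
  then have "F t = F (t + pi)" for t
    using sq[of t] by simp
  then have "F t = F 0" for t
    using const[of t 1] const[of 0 1] by (metis add_0 power_one_right mult_2 mult_left_cancel zero_neq_numeral)
  then have "F \<alpha> = F 0" .
  then show ?thesis
    using turn[OF u(2)] by (simp add: F_def)
qed

section \<open>Open sets of axes with a common angle\<close>

text \<open>
  The unit vector along \<open>cross3 x y\<close>, with the sign of \<open>sin \<alpha>\<close>, is the axis of the rotation by
  \<open>\<alpha>\<close> that takes \<open>x\<close> to \<open>y\<close>. In this form the hypothesis on axes becomes a relation between
  points, which can be used without reference to any particular plane.
\<close>
lemma turn_pair:
  assumes turn: "\<And>\<xi> x. norm \<xi> = 1 \<Longrightarrow> \<xi> \<in> N \<Longrightarrow> norm x = 1 \<Longrightarrow> x \<bullet> \<xi> = 0 \<Longrightarrow> f (rot \<xi> \<alpha> x) = g x"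
    and s: "sin \<alpha> \<noteq> 0" and x: "norm x = 1" "norm y = 1" "x \<bullet> y = cos \<alpha>"
    and N: "(1 / sin \<alpha>) *\<^sub>R cross3 x y \<in> N"
  shows "f y = g x"
proof -
  have "(norm (cross3 x y))\<^sup>2 + (cos \<alpha>)\<^sup>2 = 1"
    using norm_cross_dot[of x y] x by simp
  then have "(norm (cross3 x y))\<^sup>2 = (sin \<alpha>)\<^sup>2"
    using sin_cos_squared_add[of \<alpha>] by linarith
  then have "norm (cross3 x y) = \<bar>sin \<alpha>\<bar>"
    by (metis abs_norm_cancel power2_eq_iff abs_minus abs_norm_cancel)
  then have "norm ((1 / sin \<alpha>) *\<^sub>R cross3 x y) = 1"
    using s by simp
  from turn[OF this N x(1)] have "f (rot ((1 / sin \<alpha>) *\<^sub>R cross3 x y) \<alpha> x) = g x"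
    by (simp add: dot_cross_self)
  moreover have "rot ((1 / sin \<alpha>) *\<^sub>R cross3 x y) \<alpha> x = y"
    using s x by (simp add: rot_def cross_mult_left cross_cross_same norm_eq_1)
  ultimately show ?thesis by simp
qed

text \<open>
  Write \<open>x\<close> for \<open>rot \<xi>0 t u\<close>, a point of the circle close to \<open>u\<close>, and call two points linked if
  \<open>turn_pair\<close> applies to them. The chain from \<open>x\<close> to \<open>u\<close> has four links. The point \<open>y t\<close>,
  which is \<open>x\<close> rotated by \<open>\<alpha>\<close>, is linked with \<open>x\<close> and with the points \<open>X t w\<close>, which leave
  the circle by turning \<open>x\<close> about \<open>y t\<close>; the points \<open>Y r\<close>, which leave the circle by turning
  \<open>y 0\<close> about \<open>u\<close>, are linked with \<open>u\<close>. It remains to link some \<open>X t \<omega>\<close> with some \<open>Y r\<close>,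
  that is, to find \<open>r\<close> with \<open>X t \<omega> \<bullet> Y r = cos \<alpha>\<close>. For \<open>t = 0\<close> the solution is \<open>r = 0\<close>, and the
  left hand side crosses the value \<open>cos \<alpha>\<close> there; the crossing persists for small \<open>t\<close> by the
  intermediate value theorem.
\<close>
lemma locally_constant_on_circle:
  fixes f g :: "real^3 \<Rightarrow> 'a"
  assumes N: "open N" "\<xi>0 \<in> N" and \<xi>0: "norm \<xi>0 = 1"
    and turn: "\<And>\<xi> x. norm \<xi> = 1 \<Longrightarrow> \<xi> \<in> N \<Longrightarrow> norm x = 1 \<Longrightarrow> x \<bullet> \<xi> = 0 \<Longrightarrow> f (rot \<xi> \<alpha> x) = g x"
    and s0: "sin \<alpha> \<noteq> 0" and u: "norm u = 1" "u \<bullet> \<xi>0 = 0"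
  shows "eventually (\<lambda>t. g (rot \<xi>0 t u) = g u) (nhds 0)"
proof -
  define v where "v = cross3 \<xi>0 u"
  define c where "c = cos \<alpha>"
  define s where "s = sin \<alpha>"
  have s: "s \<noteq> 0" and cs: "c * c + s * s = 1"
    using s0 by (auto simp: s_def c_def)
  have unit: "u \<bullet> u = 1" "v \<bullet> v = 1" "\<xi>0 \<bullet> \<xi>0 = 1"
    using u \<xi>0 norm_cross_perp[OF u(2)] by (auto simp: v_def norm_eq_1[symmetric])
  have orth: "u \<bullet> v = 0" "v \<bullet> u = 0" "u \<bullet> \<xi>0 = 0" "\<xi>0 \<bullet> u = 0" "v \<bullet> \<xi>0 = 0" "\<xi>0 \<bullet> v = 0"
    using u by (auto simp: v_def dot_cross_self inner_commute)
  note expand = inner_left_distrib inner_right_distrib inner_diff_left inner_diff_right unit orth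
  define y where "y = (\<lambda>t. cos (t + \<alpha>) *\<^sub>R u + sin (t + \<alpha>) *\<^sub>R v)"
  define n where "n = (\<lambda>t. cos (t + \<alpha>) *\<^sub>R v - sin (t + \<alpha>) *\<^sub>R u)"
  define X where "X = (\<lambda>t w. c *\<^sub>R y t - (s * cos w) *\<^sub>R n t + (s * sin w) *\<^sub>R \<xi>0)"
  define Y where "Y = (\<lambda>r. c *\<^sub>R u + (s * cos r) *\<^sub>R v + (s * sin r) *\<^sub>R \<xi>0)"
  have yn: "y t \<bullet> y t = 1" "n t \<bullet> n t = 1" "y t \<bullet> n t = 0" "n t \<bullet> y t = 0"
    "y t \<bullet> \<xi>0 = 0" "\<xi>0 \<bullet> y t = 0" "n t \<bullet> \<xi>0 = 0" "\<xi>0 \<bullet> n t = 0" for t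
    by (simp_all add: y_def n_def expand)
  have sc: "s * cos w * (s * cos w) + s * sin w * (s * sin w) = s * s" for w
  proof -
    have "s * cos w * (s * cos w) + s * sin w * (s * sin w) = s * s * (cos w * cos w + sin w * sin w)"
      by (simp only: algebra_simps)
    then show ?thesis by simp
  qed
  have normX: "norm (X t w) = 1" for t w
    using cs sc[of w] by (simp add: X_def norm_eq_1 inner_left_distrib inner_right_distrib
        inner_diff_left inner_diff_right yn unit)
  have normY: "norm (Y r) = 1" for r
    using cs sc[of r] by (simp add: Y_def norm_eq_1 expand)
  have normy: "norm (y t) = 1" for t
    by (simp add: norm_eq_1 yn)
  have X0: "X 0 0 = u"
  proof -
    have "X 0 0 = (c * c + s * s) *\<^sub>R u"
      by (simp add: X_def y_def n_def algebra_simps c_def[symmetric] s_def[symmetric])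
    then show ?thesis by (simp add: cs)
  qed
  have contX: "continuous_on S (\<lambda>z. X (a z) (b z))"
    if "continuous_on S a" "continuous_on S b" for S :: "'b::t2_space set" and a b
    unfolding X_def y_def n_def by (intro continuous_intros that)
  have contY: "continuous_on S (\<lambda>z. Y (a z))"
    if "continuous_on S a" for S :: "'b::t2_space set" and a
    unfolding Y_def by (intro continuous_intros that)
  have conty: "continuous_on S (\<lambda>z. y (a z))"
    if "continuous_on S a" for S :: "'b::t2_space set" and a
    unfolding y_def by (intro continuous_intros that)
  have axis: "(1 / s) *\<^sub>R cross3 u (Y 0) = \<xi>0"
  proof -
    have "cross3 u v = \<xi>0"
      using Lagrange[of u \<xi>0 u] unit orth by (simp add: v_def)
    then show ?thesis
      using s by (simp add: Y_def cross_add_right cross_mult_right)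
  qed
  have near: "\<exists>\<eta>>0. \<forall>t w r. \<bar>t\<bar> < \<eta> \<longrightarrow> \<bar>w\<bar> < \<eta> \<longrightarrow> \<bar>r\<bar> < \<eta> \<longrightarrow> P (t, w, r) \<in> N"
    if "continuous_on UNIV P" "P (0, 0, 0) = \<xi>0" for P :: "real \<times> real \<times> real \<Rightarrow> real^3"
  proof -
    have "open (P -` N)" "(0, 0, 0) \<in> P -` N"
      using that N open_vimage by auto
    then obtain e where "e > 0" "ball (0, 0, 0) e \<subseteq> P -` N"
      by (rule openE)
    then have e: "e > 0" "\<And>z. dist z (0, 0, 0) < e \<Longrightarrow> P z \<in> N"
      by (auto simp: dist_commute subset_iff)
    have "dist (t, w, r) (0, 0, 0) < e" if "\<bar>t\<bar> < e / 3" "\<bar>w\<bar> < e / 3" "\<bar>r\<bar> < e / 3" for t w r :: real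
    proof -
      have "dist (t, w, r) (0, 0, 0) = norm (t, w, r)"
        by (metis dist_0_norm dist_commute zero_prod_def)
      then show ?thesis
        using norm_Pair_le[of t "(w, r)"] norm_Pair_le[of w r] that by simp
    qed
    then show ?thesis
      using e by (intro exI[of _ "e / 3"]) auto
  qed
  have y0: "y 0 = Y 0"
    by (simp add: y_def Y_def c_def s_def)
  obtain \<eta>1 where \<eta>1: "\<eta>1 > 0" "\<And>r. \<bar>r\<bar> < \<eta>1 \<Longrightarrow> (1 / s) *\<^sub>R cross3 u (Y r) \<in> N"
    using near[of "\<lambda>(t, w, r). (1 / s) *\<^sub>R cross3 u (Y r)"] axis
    by (force simp: split_beta intro!: continuous_intros continuous_on_cross contY)
  obtain \<eta>2 where \<eta>2: "\<eta>2 > 0"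
    "\<And>t w. \<bar>t\<bar> < \<eta>2 \<Longrightarrow> \<bar>w\<bar> < \<eta>2 \<Longrightarrow> (1 / s) *\<^sub>R cross3 (X t w) (y t) \<in> N"
    using near[of "\<lambda>(t, w, r). (1 / s) *\<^sub>R cross3 (X t w) (y t)"] axis X0 y0
    by (force simp: split_beta intro!: continuous_intros continuous_on_cross contX conty)
  obtain \<eta>3 where \<eta>3: "\<eta>3 > 0"
    "\<And>t w r. \<bar>t\<bar> < \<eta>3 \<Longrightarrow> \<bar>w\<bar> < \<eta>3 \<Longrightarrow> \<bar>r\<bar> < \<eta>3 \<Longrightarrow> (1 / s) *\<^sub>R cross3 (X t w) (Y r) \<in> N"
    using near[of "\<lambda>(t, w, r). (1 / s) *\<^sub>R cross3 (X t w) (Y r)"] axis X0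
    by (force simp: split_beta intro!: continuous_intros continuous_on_cross contX contY)
  \<comment> \<open>Within \<open>\<eta>\<close> the normals of all pairs in the chain are admissible axes.\<close>
  define \<eta> where "\<eta> = min \<eta>1 (min \<eta>2 \<eta>3)"
  have \<eta>: "\<eta> > 0" "\<eta> \<le> \<eta>1" "\<eta> \<le> \<eta>2" "\<eta> \<le> \<eta>3"
    using \<eta>1 \<eta>2 \<eta>3 by (auto simp: \<eta>_def)
  define \<omega> where "\<omega> = min 1 (\<eta> / 2)"
  have \<omega>: "0 < \<omega>" "\<omega> < \<eta>" "\<omega> \<le> 1"
    using \<eta> by (auto simp: \<omega>_def min_def)
  define h where "h = (\<lambda>t r. X t \<omega> \<bullet> Y r)"
  have h0: "h 0 r - c = s * s * (sin \<omega> * sin r - c * ((1 - cos \<omega>) * (1 - cos r)))" for r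
  proof -
    have "h 0 r = c * (c * c + s * s * cos \<omega>) + s * cos r * (c * s - c * s * cos \<omega>)
        + s * sin r * (s * sin \<omega>)"
      unfolding h_def X_def Y_def y_def n_def c_def[symmetric] s_def[symmetric] add_0
      by (simp add: expand algebra_simps)
    moreover have "c = c * (c * c + s * s)"
      by (simp add: cs)
    ultimately show ?thesis
      by (simp add: algebra_simps)
  qed
  have cos\<omega>: "0 < cos \<omega>" "cos \<omega> < 1"
    using \<omega> pi_gt3 cos_monotone_0_pi[of 0 \<omega>] by (auto intro!: cos_gt_zero)
  have c1: "\<bar>c\<bar> \<le> 1"
    by (simp add: c_def)
  \<comment> \<open>In \<open>h0\<close> at \<open>r = \<omega>\<close> and \<open>r = - \<omega>\<close> the odd first term dominates the even second one.\<close>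
  have key: "\<bar>c * ((1 - cos \<omega>) * (1 - cos \<omega>))\<bar> < sin \<omega> * sin \<omega>"
  proof -
    have "\<bar>c * ((1 - cos \<omega>) * (1 - cos \<omega>))\<bar> \<le> 1 * ((1 - cos \<omega>) * (1 - cos \<omega>))"
      unfolding abs_mult[of c] by (rule mult_mono) (use c1 in auto)
    also have "\<dots> < (1 - cos \<omega>) * (1 + cos \<omega>)"
      using cos\<omega> by simp
    also have "\<dots> = sin \<omega> * sin \<omega>"
      using sin_cos_squared_add3[of \<omega>] by (simp add: algebra_simps)
    finally show ?thesis .
  qed
  have ss: "s * s > 0"
    using s not_real_square_gt_zero by blast
  have "h 0 \<omega> - c > 0" "h 0 (- \<omega>) - c < 0"
    unfolding h0 using key ss by (auto intro!: mult_pos_pos mult_pos_neg simp: abs_less_iff)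
  then have signs: "h 0 \<omega> > c" "h 0 (- \<omega>) < c"
    by auto
  have conth: "isCont (\<lambda>t. h t r) 0" for r
  proof -
    have "continuous_on UNIV (\<lambda>t. h t r)"
      unfolding h_def by (intro continuous_intros contX)
    then show ?thesis by (simp add: continuous_on_eq_continuous_at)
  qed
  have lim: "((\<lambda>t. h t r) \<longlongrightarrow> h 0 r) (nhds 0)" for r
    using conth[of r] by (simp add: isCont_def tendsto_at_iff_tendsto_nhds[where g = "\<lambda>t. h t r"])
  have ev: "eventually (\<lambda>t. h t \<omega> > c) (nhds 0)" "eventually (\<lambda>t. h t (- \<omega>) < c) (nhds 0)"
    using order_tendstoD[OF lim] signs by auto
  have ev3: "eventually (\<lambda>t::real. \<bar>t\<bar> < \<eta>) (nhds 0)"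
    using eventually_nhds_metric[of _ "0::real"] \<eta> by (auto simp: dist_real_def)
  show ?thesis
    using ev(1) ev(2) ev3
  proof eventually_elim
    case (elim t)
    have "continuous_on {- \<omega>..\<omega>} (h t)"
      unfolding h_def by (intro continuous_intros contY)
    then obtain r where r: "- \<omega> \<le> r" "r \<le> \<omega>" "h t r = c"
      using IVT'[of "h t" "- \<omega>" c \<omega>] elim \<omega> by auto
    note pair = turn_pair[of N f \<alpha> g, OF turn s0]
    have bound: "\<bar>r\<bar> < \<eta>" "\<bar>\<omega>\<bar> < \<eta>"
      using r \<omega> by auto
    have "g (rot \<xi>0 t u) = f (rot \<xi>0 \<alpha> (rot \<xi>0 t u))"
      using turn[OF \<xi>0 N(2)] u \<xi>0 by (simp add: norm_rot rot_perp)
    also have "rot \<xi>0 \<alpha> (rot \<xi>0 t u) = y t"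
      using rot_rot[OF \<xi>0 u(2)] by (simp add: rot_def y_def v_def add.commute)
    also have "f (y t) = g (X t \<omega>)"
    proof (rule pair)
      show "X t \<omega> \<bullet> y t = cos \<alpha>"
        by (simp add: X_def inner_left_distrib inner_diff_left yn c_def)
    qed (use normX normy \<eta>2(2) elim bound \<eta> in \<open>auto simp: s_def[symmetric]\<close>)
    also have "\<dots> = f (Y r)"
      by (rule pair[symmetric])
        (use normX normY \<eta>3(2) elim bound \<eta> r(3) in \<open>auto simp: s_def[symmetric] h_def c_def[symmetric]\<close>)
    also have "\<dots> = g u"
      by (rule pair)
        (use u normY \<eta>1(2) bound \<eta> in \<open>auto simp: s_def[symmetric] c_def[symmetric] Y_def expand\<close>)
    finally show ?case .
  qed
qed

text \<open>
  Once \<open>g\<close> is constant on the circle, rotating by \<open>\<alpha>\<close> or not makes no difference.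
\<close>
lemma interior_turn:
  fixes f g :: "real^3 \<Rightarrow> 'a"
  assumes N: "open N" "\<xi> \<in> N" and \<xi>: "norm \<xi> = 1"
    and turn: "\<And>\<xi> x. norm \<xi> = 1 \<Longrightarrow> \<xi> \<in> N \<Longrightarrow> norm x = 1 \<Longrightarrow> x \<bullet> \<xi> = 0 \<Longrightarrow> f (rot \<xi> \<alpha> x) = g x"
    and s: "sin \<alpha> \<noteq> 0" and u: "norm u = 1" "u \<bullet> \<xi> = 0"
  shows "f u = g u"
proof -
  define G where "G = (\<lambda>t. g (rot \<xi> t u))"
  have "\<exists>T. openin (top_of_set UNIV) T \<and> a \<in> T \<and> (\<forall>t\<in>T. G t = G a)" for a
  proof -
    have "eventually (\<lambda>t. g (rot \<xi> t (rot \<xi> a u)) = g (rot \<xi> a u)) (nhds 0)"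
      using u \<xi> by (intro locally_constant_on_circle[where f = f and \<alpha> = \<alpha>, OF N \<xi> turn s]) (auto simp: norm_rot rot_perp)
    then obtain T where T: "open T" "0 \<in> T" "\<And>t. t \<in> T \<Longrightarrow> G (t + a) = G a"
      using rot_rot[OF \<xi> u(2)] by (auto simp: eventually_nhds G_def)
    show ?thesis
      using T(2,3) open_translation[OF T(1), of a]
      by (intro exI[of _ "(+) a ` T"]) (auto simp: add.commute)
  qed
  then have "G constant_on UNIV"
    by (intro locally_constant_imp_constant) auto
  then have "G (- \<alpha>) = G 0"
    by (auto simp: constant_on_def)
  moreover have "G (- \<alpha>) = f u"
    using turn[OF \<xi> N(2), of "rot \<xi> (- \<alpha>) u"] u \<xi> by (simp add: G_def norm_rot rot_perp rot_rot)
  ultimately show ?thesis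
    by (simp add: G_def)
qed

section \<open>The functional theorem\<close>

text \<open>
  A form of Baire's theorem for covers: the points at which one of countably many closed
  sets that cover \<open>S\<close> contains a whole neighbourhood are dense in \<open>S\<close>.
\<close>
lemma Baire_closed_cover:
  fixes S :: "'a::{real_normed_vector,heine_borel} set"
  assumes S: "closed S" and cnt: "countable \<C>" and cl: "\<And>C. C \<in> \<C> \<Longrightarrow> closed C"
    and cover: "S \<subseteq> \<Union>\<C>"
  shows "S \<subseteq> closure {x \<in> S. \<exists>C\<in>\<C>. \<exists>N. open N \<and> x \<in> N \<and> S \<inter> N \<subseteq> C}"
proof (cases "\<C> = {}")
  case False
  \<comment> \<open>If \<open>x \<notin> U\<close>, then no \<open>C\<close> contains a neighbourhood of \<open>x\<close> in \<open>S\<close>, so \<open>S - C \<union> U\<close> is dense;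
     and a point in all these sets is in \<open>U\<close>, because it lies in some \<open>C\<close>.\<close>
  define U where "U = {x \<in> S. \<exists>C\<in>\<C>. \<exists>N. open N \<and> x \<in> N \<and> S \<inter> N \<subseteq> C}"
  have opU: "openin (top_of_set S) U"
  proof -
    have "U = S \<inter> \<Union>{N. open N \<and> (\<exists>C\<in>\<C>. S \<inter> N \<subseteq> C)}"
      by (auto simp: U_def)
    then show ?thesis
      by (metis (no_types, lifting) mem_Collect_eq open_Union openin_open)
  qed
  have "S \<subseteq> closure (\<Inter>((\<lambda>C. S - C \<union> U) ` \<C>))"
  proof (rule Baire[OF S])
    fix T assume "T \<in> (\<lambda>C. S - C \<union> U) ` \<C>"
    then obtain C where C: "C \<in> \<C>" "T = S - C \<union> U" by blast
    have "openin (top_of_set S) (S - C)"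
      using cl[OF C(1)] by (metis Diff_eq open_Compl openin_open)
    moreover have "S \<subseteq> closure T"
    proof
      fix x assume x: "x \<in> S"
      have "\<exists>z\<in>T. z \<in> N" if "open N" "x \<in> N" for N
      proof (cases "S \<inter> N \<subseteq> C")
        case True
        then have "x \<in> U" using that x C(1) by (auto simp: U_def)
        then show ?thesis using that C by auto
      qed (use C in auto)
      then show "x \<in> closure T"
        by (meson closure_iff_nhds_not_empty disjoint_iff subsetD)
    qed
    ultimately show "openin (top_of_set S) T \<and> S \<subseteq> closure T"
      using opU C(2) by auto
  qed (use cnt in auto)
  also have "\<dots> \<subseteq> closure U"
    using cover False by (intro closure_mono) (auto simp: U_def)
  finally show ?thesis
    by (simp add: U_def)
qed (use cover in auto)

lemma eq_on_plane_if_eq_on_circle: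
  fixes f g :: "real^3 \<Rightarrow> real"
  assumes hom: "\<And>a x. 0 \<le> a \<Longrightarrow> f (a *\<^sub>R x) = a * f x" "\<And>a x. 0 \<le> a \<Longrightarrow> g (a *\<^sub>R x) = a * g x"
    and eq: "\<And>u. norm u = 1 \<Longrightarrow> u \<bullet> \<xi> = 0 \<Longrightarrow> f u = g u" and x: "x \<bullet> \<xi> = 0"
  shows "f x = g x"
proof (cases "x = 0")
  case True
  then show ?thesis using hom(1)[of 0 x] hom(2)[of 0 x] by simp
next
  case False
  then have "f (x /\<^sub>R norm x) = g (x /\<^sub>R norm x)"
    using x by (intro eq) auto
  then show ?thesis
    using False by (simp add: hom)
qed

lemma perp_to_two:
  fixes x y :: "real^3"
  obtains \<xi> where "norm \<xi> = 1" "x \<bullet> \<xi> = 0" "y \<bullet> \<xi> = 0"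
proof -
  have "dim {x, y} \<le> card {x, y}"
    by (rule dim_le_card) (auto simp: span_superset)
  also have "\<dots> < DIM(real^3)"
    by (simp add: card_insert_if)
  finally obtain z where z: "z \<noteq> 0" "\<And>w. w \<in> span {x, y} \<Longrightarrow> orthogonal z w"
    using orthogonal_to_subspace_exists[of "{x, y}"] by blast
  show thesis
    by (rule that[of "z /\<^sub>R norm z"])
      (use z(1) z(2)[of x] z(2)[of y] in \<open>auto simp: orthogonal_def inner_commute span_base\<close>)
qed

text \<open>
  The set \<open>\<Xi> \<alpha>\<close> consists of the axes for which the angle \<open>\<alpha>\<close> works. Countably many of these
  sets cover the sphere, and their interior axes lie in the closed set \<open>\<Xi> 0 \<union> \<Xi> pi\<close>, which is
  therefore the whole sphere. Homogeneity is what carries equality of \<open>f\<close> and \<open>g\<close> on a unit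
  circle over to its plane.
\<close>
theorem continual_rubik:
  fixes f g :: "real^3 \<Rightarrow> real"
  assumes cf: "continuous_on UNIV f" and cg: "continuous_on UNIV g"
    and hf: "\<And>a x. 0 \<le> a \<Longrightarrow> f (a *\<^sub>R x) = a * f x"
    and hg: "\<And>a x. 0 \<le> a \<Longrightarrow> g (a *\<^sub>R x) = a * g x"
    and turn: "\<And>\<xi>. norm \<xi> = 1 \<Longrightarrow> \<exists>\<alpha>. \<forall>x. x \<bullet> \<xi> = 0 \<longrightarrow> f (rot \<xi> \<alpha> x) = g x"
  shows "(\<forall>x. f x = g x) \<or> (\<forall>x. f (- x) = g x)"
proof -
  define \<Xi> where "\<Xi> = (\<lambda>\<alpha>. {\<xi>. norm \<xi> = 1 \<and> (\<forall>x. x \<bullet> \<xi> = 0 \<longrightarrow> f (rot \<xi> \<alpha> x) = g x)})"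
  have closed: "closed (\<Xi> \<alpha>)" for \<alpha>
  proof -
    \<comment> \<open>The vectors subject to the condition depend on \<open>\<xi>\<close>. Parametrizing them by \<open>P x \<xi>\<close>,
       the orthogonal projection of an arbitrary \<open>x\<close>, gives one closed condition for each \<open>x\<close>.\<close>
    define P where "P = (\<lambda>(x::real^3) \<xi>. x - (x \<bullet> \<xi>) *\<^sub>R \<xi>)"
    have P: "P x \<xi> \<bullet> \<xi> = 0" if "norm \<xi> = 1" for x \<xi>
      using that by (simp add: P_def inner_diff_left norm_eq_1)
    have "\<Xi> \<alpha> = sphere 0 1 \<inter> (\<Inter>x. {\<xi>. f (rot \<xi> \<alpha> (P x \<xi>)) = g (P x \<xi>)})"
    proof (intro set_eqI iffI)
      fix \<xi> assume "\<xi> \<in> sphere 0 1 \<inter> (\<Inter>x. {\<xi>. f (rot \<xi> \<alpha> (P x \<xi>)) = g (P x \<xi>)})"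
      then have "norm \<xi> = 1" "\<And>x. f (rot \<xi> \<alpha> (P x \<xi>)) = g (P x \<xi>)" by auto
      then show "\<xi> \<in> \<Xi> \<alpha>"
        unfolding \<Xi>_def by (auto simp: P_def) (metis diff_zero scale_zero_left)
    qed (auto simp: \<Xi>_def P)
    moreover have "closed {\<xi>. f (rot \<xi> \<alpha> (P x \<xi>)) = g (P x \<xi>)}" for x
      unfolding P_def
      by (intro closed_Collect_eq continuous_on_compose2[OF cf] continuous_on_compose2[OF cg]
          continuous_intros) auto
    ultimately show ?thesis
      by (auto intro!: closed_Int closed_INT)
  qed
  have sums: "f x ^ n + f (- x) ^ n = g x ^ n + g (- x) ^ n" if "norm x = 1" for x n
    using power_sums_agree[OF cf cg turn that] .
  have upgrade: "\<xi> \<in> \<Xi> 0" if "norm \<xi> = 1" "\<And>u. norm u = 1 \<Longrightarrow> u \<bullet> \<xi> = 0 \<Longrightarrow> f u = g u" for \<xi>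
    using that eq_on_plane_if_eq_on_circle[of f g, OF hf hg] by (auto simp: \<Xi>_def)
  define \<C> where "\<C> = (\<lambda>r. \<Xi> (2 * pi * r)) ` \<rat>"
  have cover: "sphere 0 1 \<subseteq> \<Union>\<C>"
  proof
    fix \<xi> :: "real^3" assume "\<xi> \<in> sphere 0 1"
    then have \<xi>: "norm \<xi> = 1" by simp
    obtain \<alpha> where \<alpha>: "\<And>x. x \<bullet> \<xi> = 0 \<Longrightarrow> f (rot \<xi> \<alpha> x) = g x"
      using turn[OF \<xi>] by blast
    show "\<xi> \<in> \<Union>\<C>"
    proof (cases "\<alpha> / (2 * pi) \<in> \<rat>")
      case True
      moreover have "\<xi> \<in> \<Xi> (2 * pi * (\<alpha> / (2 * pi)))"
        using \<xi> \<alpha> by (simp add: \<Xi>_def)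
      ultimately show ?thesis
        unfolding \<C>_def by blast
    next
      case False
      then have "\<xi> \<in> \<Xi> (2 * pi * 0)"
        using irrational_turn[OF cf sums \<xi> \<alpha> False] upgrade[OF \<xi>] by simp
      then show ?thesis
        unfolding \<C>_def using Rats_0 by blast
    qed
  qed
  have interior: "\<xi> \<in> \<Xi> 0 \<union> \<Xi> pi"
    if \<xi>: "norm \<xi> = 1" and N: "open N" "\<xi> \<in> N" "sphere 0 1 \<inter> N \<subseteq> \<Xi> \<alpha>" for \<xi> N \<alpha>
  proof (cases "sin \<alpha> = 0")
    case True
    have "\<xi> \<in> \<Xi> \<alpha>" using \<xi> N by auto
    moreover have "\<bar>cos \<alpha>\<bar> = 1"
      using True by (rule sin_zero_abs_cos_one)
    then have "rot \<xi> \<alpha> = rot \<xi> 0 \<or> rot \<xi> \<alpha> = rot \<xi> pi"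
      using True by (auto simp: rot_def fun_eq_iff abs_if split: if_splits)
    ultimately show ?thesis
      by (auto simp: \<Xi>_def)
  next
    case False
    have "f u = g u" if "norm u = 1" "u \<bullet> \<xi> = 0" for u
      using N(3) by (intro interior_turn[of N \<xi> f \<alpha> g u, OF N(1,2) \<xi> _ False that]) (auto simp: \<Xi>_def)
    then show ?thesis
      using upgrade[OF \<xi>] by simp
  qed
  have "sphere 0 1 \<subseteq> closure {\<xi> \<in> sphere 0 1. \<exists>C\<in>\<C>. \<exists>N. open N \<and> \<xi> \<in> N \<and> sphere 0 1 \<inter> N \<subseteq> C}"
    by (rule Baire_closed_cover[OF _ _ _ cover]) (auto simp: \<C>_def closed countable_rat)
  also have "\<dots> \<subseteq> closure (\<Xi> 0 \<union> \<Xi> pi)"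
    using interior by (intro closure_mono) (auto simp: \<C>_def)
  also have "\<dots> = \<Xi> 0 \<union> \<Xi> pi"
    by (intro closure_closed closed_Un closed)
  finally have dich: "\<xi> \<in> \<Xi> 0 \<or> \<xi> \<in> \<Xi> pi" if "norm \<xi> = 1" for \<xi>
    using that by auto
  show ?thesis
  proof (rule ccontr)
    assume "\<not> ?thesis"
    then obtain x y where xy: "f x \<noteq> g x" "f (- y) \<noteq> g y" by auto
    obtain \<xi> where "norm \<xi> = 1" "x \<bullet> \<xi> = 0" "y \<bullet> \<xi> = 0"
      by (rule perp_to_two)
    then show False
      using dich[of \<xi>] xy by (auto simp: \<Xi>_def rot_def)
  qed
qed

section \<open>Support functions and projections\<close>

definition support_fun :: "'a::euclidean_space set \<Rightarrow> 'a \<Rightarrow> real" where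
  "support_fun K x = (SUP y\<in>K. x \<bullet> y)"

lemma bdd_above_inner: "compact K \<Longrightarrow> bdd_above ((\<lambda>y. x \<bullet> y) ` K)" for x :: "'a::euclidean_space"
  by (intro bounded_imp_bdd_above compact_imp_bounded compact_continuous_image continuous_intros)

lemma inner_le_support_fun: "compact K \<Longrightarrow> y \<in> K \<Longrightarrow> x \<bullet> y \<le> support_fun K x"
  unfolding support_fun_def by (intro cSUP_upper bdd_above_inner)

lemma support_fun_le: "K \<noteq> {} \<Longrightarrow> (\<And>y. y \<in> K \<Longrightarrow> x \<bullet> y \<le> b) \<Longrightarrow> support_fun K x \<le> b"
  unfolding support_fun_def by (rule cSUP_least)

lemma continuous_on_support_fun:
  assumes K: "compact K" "K \<noteq> {}"
  shows "continuous_on S (support_fun K)"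
proof -
  obtain B where B: "B > 0" "\<And>y. y \<in> K \<Longrightarrow> norm y \<le> B"
    using compact_imp_bounded[OF K(1)] bounded_pos by metis
  have le: "support_fun K x - support_fun K z \<le> B * dist x z" for x z
  proof -
    have "support_fun K x \<le> support_fun K z + B * dist x z"
    proof (rule support_fun_le[OF K(2)])
      fix y assume y: "y \<in> K"
      have "x \<bullet> y = z \<bullet> y + (x - z) \<bullet> y"
        by (simp add: inner_diff_left)
      also have "(x - z) \<bullet> y \<le> norm (x - z) * norm y"
        by (rule norm_cauchy_schwarz)
      also have "\<dots> \<le> dist x z * B"
        using B(2)[OF y] by (simp add: dist_norm mult_left_mono)
      finally show "x \<bullet> y \<le> support_fun K z + B * dist x z"
        using inner_le_support_fun[OF K(1) y, of z] by (simp add: mult.commute)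
    qed
    then show ?thesis by simp
  qed
  have "dist (support_fun K x) (support_fun K z) \<le> B * dist x z" for x z
    using le[of x z] le[of z x] by (simp add: dist_real_def abs_le_iff dist_commute)
  then have "B-lipschitz_on S (support_fun K)"
    using B(1) by (intro lipschitz_onI) auto
  then show ?thesis
    by (rule lipschitz_on_continuous_on)
qed

lemma support_fun_scaleR:
  assumes K: "compact K" "K \<noteq> {}" and a: "0 \<le> a"
  shows "support_fun K (a *\<^sub>R x) = a * support_fun K x"
proof (cases "a = 0")
  case True
  then show ?thesis using K(2) by (simp add: support_fun_def)
next
  case False
  then have a: "a > 0" using a by simp
  show ?thesis
  proof (rule antisym)
    show "support_fun K (a *\<^sub>R x) \<le> a * support_fun K x"
      using a inner_le_support_fun[OF K(1)] by (intro support_fun_le[OF K(2)]) simp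
    have "support_fun K x \<le> support_fun K (a *\<^sub>R x) / a"
      using a inner_le_support_fun[OF K(1), of _ "a *\<^sub>R x"]
      by (intro support_fun_le[OF K(2)]) (simp add: field_simps)
    then show "a * support_fun K x \<le> support_fun K (a *\<^sub>R x)"
      using a by (simp add: field_simps)
  qed
qed

lemma support_fun_uminus: "support_fun (uminus ` K) x = support_fun K (- x)"
  by (simp add: support_fun_def image_comp o_def)

text \<open>
  A point outside \<open>L\<close> is separated from \<open>L\<close> by a plane, and the support functions at a normal
  of this plane compare the wrong way round.
\<close>
lemma subset_if_support_fun_le:
  assumes K: "compact K" and L: "compact L" "convex L" "L \<noteq> {}"
    and le: "\<And>x. support_fun K x \<le> support_fun L x"
  shows "K \<subseteq> L"
proof
  fix z assume z: "z \<in> K"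
  show "z \<in> L"
  proof (rule ccontr)
    assume "z \<notin> L"
    then obtain a b where ab: "a \<bullet> z < b" "\<And>x. x \<in> L \<Longrightarrow> b < a \<bullet> x"
      using separating_hyperplane_closed_point[OF L(2) compact_imp_closed[OF L(1)]] by blast
    have "support_fun L (- a) \<le> - b"
      using ab(2) by (intro support_fun_le[OF L(3)]) (simp add: less_imp_le)
    then show False
      using inner_le_support_fun[OF K z, of "- a"] le[of "- a"] ab(1) by simp
  qed
qed

lemma eq_if_support_fun_eq:
  assumes "compact K" "convex K" "K \<noteq> {}" "compact L" "convex L" "L \<noteq> {}"
    and "\<And>x. support_fun K x = support_fun L x"
  shows "K = L"
  using assms by (intro equalityI subset_if_support_fun_le) auto

lemma support_fun_projection:
  assumes "norm \<xi> = 1" "x \<bullet> \<xi> = 0"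
  shows "support_fun (projection \<xi> K) x = support_fun K x"
proof -
  have "(\<lambda>y. x \<bullet> y) ` projection \<xi> K = (\<lambda>y. x \<bullet> y) ` K"
  proof (intro equalityI subsetI)
    fix r assume "r \<in> (\<lambda>y. x \<bullet> y) ` projection \<xi> K"
    then obtain y t where y: "r = x \<bullet> y" "y + t *\<^sub>R \<xi> \<in> K"
      by (auto simp: projection_def)
    moreover have "x \<bullet> y = x \<bullet> (y + t *\<^sub>R \<xi>)"
      using assms by (simp add: inner_right_distrib)
    ultimately show "r \<in> (\<lambda>y. x \<bullet> y) ` K" by blast
  next
    fix r assume "r \<in> (\<lambda>y. x \<bullet> y) ` K"
    then obtain y where y: "r = x \<bullet> y" "y \<in> K" by blast
    have "y - (y \<bullet> \<xi>) *\<^sub>R \<xi> \<in> projection \<xi> K"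
      using y assms by (auto simp: projection_def perp_def inner_diff_left norm_eq_1
          intro!: exI[of _ "y \<bullet> \<xi>"])
    moreover have "r = x \<bullet> (y - (y \<bullet> \<xi>) *\<^sub>R \<xi>)"
      using y assms by (simp add: inner_diff_right)
    ultimately show "r \<in> (\<lambda>y. x \<bullet> y) ` projection \<xi> K" by blast
  qed
  then show ?thesis
    by (simp add: support_fun_def)
qed

lemma plane_expansion:
  assumes \<xi>: "norm \<xi> = 1" and u: "norm u = 1" "u \<bullet> \<xi> = 0" and x: "x \<bullet> \<xi> = 0"
  shows "x = (x \<bullet> u) *\<^sub>R u + (x \<bullet> cross3 \<xi> u) *\<^sub>R cross3 \<xi> u"
proof -
  have "cross3 u (cross3 \<xi> u) = \<xi>"
    using u Lagrange[of u \<xi> u] by (simp add: norm_eq_1)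
  then have "cross3 x \<xi> = (x \<bullet> cross3 \<xi> u) *\<^sub>R u - (x \<bullet> u) *\<^sub>R cross3 \<xi> u"
    using Lagrange[of x u "cross3 \<xi> u"] by simp
  then have "cross3 \<xi> (cross3 x \<xi>) = (x \<bullet> cross3 \<xi> u) *\<^sub>R cross3 \<xi> u + (x \<bullet> u) *\<^sub>R u"
    using cross_cross_perp[OF \<xi> u(2)] by (simp add: Cross3.right_diff_distrib cross_mult_right)
  moreover have "cross3 \<xi> (cross3 x \<xi>) = x"
    using \<xi> x Lagrange[of \<xi> x \<xi>] by (simp add: norm_eq_1 inner_commute)
  ultimately show ?thesis by (simp add: add.commute)
qed

text \<open>
  In the orthonormal basis \<open>u, v\<close> of the plane, \<open>\<phi>\<close> is an orthogonal matrix with columns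
  \<open>(c, s)\<close> and \<open>(a, b)\<close>; preservation of orientation makes its determinant \<open>c * b - s * a\<close>
  equal to \<open>1\<close> rather than \<open>- 1\<close>, and then \<open>(a + s)\<^sup>2 + (b - c)\<^sup>2 = 0\<close>.
\<close>
lemma plane_rotation_imp_rot:
  assumes \<xi>: "norm \<xi> = 1" and rot: "plane_rotation \<xi> \<phi>"
  obtains \<alpha> where "\<And>x. x \<bullet> \<xi> = 0 \<Longrightarrow> \<phi> x = rot \<xi> \<alpha> x"
proof -
  obtain u where u: "norm u = 1" "u \<bullet> \<xi> = 0"
    by (rule unit_perp_exists)
  define v where "v = cross3 \<xi> u"
  have v: "norm v = 1" "v \<bullet> \<xi> = 0"
    using u \<xi> by (auto simp: v_def norm_cross_perp dot_cross_self)
  have unit: "u \<bullet> u = 1" "v \<bullet> v = 1" "\<xi> \<bullet> \<xi> = 1"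
    using u v \<xi> by (auto simp: norm_eq_1)
  have orth: "u \<bullet> v = 0" "v \<bullet> u = 0"
    by (simp_all add: v_def dot_cross_self)
  have uv: "cross3 u v = \<xi>" "cross3 v u = - \<xi>"
    using unit(1) u(2) Lagrange[of u \<xi> u] cross_skew[of v u] by (simp_all add: v_def)
  have add: "\<phi> (x + y) = \<phi> x + \<phi> y" if "x \<bullet> \<xi> = 0" "y \<bullet> \<xi> = 0" for x y
    using rot that by (simp add: plane_rotation_def perp_def)
  have scale: "\<phi> (a *\<^sub>R x) = a *\<^sub>R \<phi> x" if "x \<bullet> \<xi> = 0" for a x
    using rot that by (simp add: plane_rotation_def perp_def)
  have norm: "norm (\<phi> x) = norm x" if "x \<bullet> \<xi> = 0" for x
    using rot that by (simp add: plane_rotation_def perp_def)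
  have perp: "\<phi> x \<bullet> \<xi> = 0" if "x \<bullet> \<xi> = 0" for x
    using rot that by (auto simp: plane_rotation_def perp_def)
  define c s a b where "c = \<phi> u \<bullet> u" and "s = \<phi> u \<bullet> v" and "a = \<phi> v \<bullet> u" and "b = \<phi> v \<bullet> v"
  have \<phi>u: "\<phi> u = c *\<^sub>R u + s *\<^sub>R v"
    unfolding c_def s_def v_def by (rule plane_expansion[OF \<xi> u perp[OF u(2)]])
  have \<phi>v: "\<phi> v = a *\<^sub>R u + b *\<^sub>R v"
    unfolding a_def b_def using plane_expansion[OF \<xi> u perp[OF v(2)]] by (simp add: v_def)
  note expand = inner_left_distrib inner_right_distrib unit orth
  have cs: "c * c + s * s = 1"
    using norm[OF u(2)] u(1) \<phi>u by (simp add: norm_eq_1 expand)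
  have ab: "a * a + b * b = 1"
    using norm[OF v(2)] v(1) \<phi>v by (simp add: norm_eq_1 expand)
  have "norm (\<phi> (u + v)) = norm (u + v)"
    using u v by (intro norm) (simp add: inner_left_distrib)
  then have "\<phi> (u + v) \<bullet> \<phi> (u + v) = (u + v) \<bullet> (u + v)"
    by (simp add: norm_eq)
  then have "(c + a) * (c + a) + (s + b) * (s + b) = 2"
    unfolding add[OF u(2) v(2)] \<phi>u \<phi>v by (simp add: expand algebra_simps)
  then have ortho: "c * a + s * b = 0"
    using cs ab by (simp add: algebra_simps)
  have "\<xi> \<bullet> cross3 (\<phi> u) (\<phi> v) > 0"
    using rot u v uv unit by (simp add: plane_rotation_def perp_def)
  then have pos: "c * b - s * a > 0"
    unfolding \<phi>u \<phi>v
    by (simp add: cross_add_left cross_add_right cross_mult_left cross_mult_right uv expand algebra_simps)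
  have "(c * b - s * a) * (c * b - s * a)
      = (c * c + s * s) * (a * a + b * b) - (c * a + s * b) * (c * a + s * b)"
    by (simp add: algebra_simps)
  then have "(c * b - s * a)\<^sup>2 = 1"
    by (simp add: cs ab ortho power2_eq_square)
  then have det: "c * b - s * a = 1"
    using pos by (auto simp: power2_eq_1_iff)
  have "(a + s)\<^sup>2 + (b - c)\<^sup>2 = (a * a + b * b) + (c * c + s * s) - 2 * (c * b - s * a)"
    by (simp add: power2_eq_square algebra_simps)
  then have "a = - s" "b = c"
    unfolding ab cs det by (auto simp: sum_power2_eq_zero_iff)
  obtain \<alpha> where \<alpha>: "c = cos \<alpha>" "s = sin \<alpha>"
    using cs sincos_total_2pi[of c s] by (auto simp: power2_eq_square)
  have \<xi>v: "cross3 \<xi> v = - u"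
    unfolding v_def by (rule cross_cross_perp[OF \<xi> u(2)])
  show thesis
  proof (rule that)
    fix x assume "x \<bullet> \<xi> = 0"
    from plane_expansion[OF \<xi> u this] obtain p q where x: "x = p *\<^sub>R u + q *\<^sub>R v"
      unfolding v_def by blast
    have "\<phi> x = p *\<^sub>R \<phi> u + q *\<^sub>R \<phi> v"
      using u(2) v(2) by (simp add: x add scale)
    also have "\<dots> = rot \<xi> \<alpha> x"
      unfolding \<phi>u \<phi>v \<open>a = - s\<close> \<open>b = c\<close> x \<alpha>
      by (simp add: rot_def cross_add_right cross_mult_right v_def[symmetric] \<xi>v algebra_simps)
    finally show "\<phi> x = rot \<xi> \<alpha> x" .
  qed
qed

text \<open>
  Both bodies are recovered from their support functions, and replacing \<open>L\<close> by \<open>- L\<close> amounts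
  to composing its support function with \<open>x \<mapsto> - x\<close>. If \<open>\<phi>\<close> takes one projection to the
  other, then the support function of \<open>L\<close> at \<open>\<phi> x\<close> is that of \<open>K\<close> at \<open>x\<close>, because \<open>\<phi>\<close> preserves
  inner products.
\<close>
theorem theorem1:
  fixes K L :: "(real^3) set"
  assumes "convex_body K" and "convex_body L"
    and "0 \<in> interior K" and "0 \<in> interior L"
    and "\<And>\<xi>. \<xi> \<in> sphere 0 1 \<Longrightarrow>
           \<exists>\<phi>. plane_rotation \<xi> \<phi> \<and> \<phi> ` projection \<xi> K = projection \<xi> L"
  shows "K = L \<or> K = uminus ` L"
proof -
  have K: "compact K" "convex K" "K \<noteq> {}" and L: "compact L" "convex L" "L \<noteq> {}"
    using assms(1,2) interior_subset by (auto simp: convex_body_def)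
  have "\<exists>\<alpha>. \<forall>x. x \<bullet> \<xi> = 0 \<longrightarrow> support_fun L (rot \<xi> \<alpha> x) = support_fun K x"
    if \<xi>: "norm \<xi> = 1" for \<xi>
  proof -
    obtain \<phi> where \<phi>: "plane_rotation \<xi> \<phi>" "\<phi> ` projection \<xi> K = projection \<xi> L"
      using assms(5)[of \<xi>] \<xi> by auto
    obtain \<alpha> where \<alpha>: "\<And>x. x \<bullet> \<xi> = 0 \<Longrightarrow> \<phi> x = rot \<xi> \<alpha> x"
      using plane_rotation_imp_rot[OF \<xi> \<phi>(1)] by blast
    have p: "y \<bullet> \<xi> = 0" if "y \<in> projection \<xi> K" for y
      using that by (simp add: projection_def perp_def)
    have "support_fun L (rot \<xi> \<alpha> x) = support_fun K x" if x: "x \<bullet> \<xi> = 0" for x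
    proof -
      have "support_fun L (rot \<xi> \<alpha> x) = support_fun (\<phi> ` projection \<xi> K) (rot \<xi> \<alpha> x)"
        using support_fun_projection[OF \<xi> rot_perp[OF x]] by (simp add: \<phi>(2))
      also have "\<dots> = support_fun (projection \<xi> K) x"
        unfolding support_fun_def image_comp
        by (intro SUP_cong refl) (simp add: \<alpha> p inner_rot[OF \<xi> x])
      also have "\<dots> = support_fun K x"
        by (rule support_fun_projection[OF \<xi> x])
      finally show ?thesis .
    qed
    then show ?thesis by blast
  qed
  then have "(\<forall>x. support_fun L x = support_fun K x) \<or> (\<forall>x. support_fun L (- x) = support_fun K x)"
    using K L by (intro continual_rubik continuous_on_support_fun support_fun_scaleR) auto
  then show ?thesis
  proof
    assume "\<forall>x. support_fun L x = support_fun K x"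
    then have "K = L"
      using K L by (intro eq_if_support_fun_eq) auto
    then show ?thesis ..
  next
    assume "\<forall>x. support_fun L (- x) = support_fun K x"
    then have "K = uminus ` L"
      using K L by (intro eq_if_support_fun_eq)
        (auto simp: support_fun_uminus intro: compact_negations convex_negations)
    then show ?thesis ..
  qed
qed

end
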